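(* Let $d\ge2$ and let $\varepsilon>0$. Suppose that $H\ge H_0(d,\varepsilon)$ (sufficiently large in terms of $d$ and $\varepsilon$), and set $$x=H^{1/(4d)},\qquad \eta=\frac{\log x}{\log\log x},\qquad \theta=\frac{\log\log x}{\log\log\log x}.$$ Let $f:\mathbb{Z}\to\mathbb{C}$ be a function satisfying the following conditions. (B) $|f(n)|\ll1$ for every $n\in\mathbb{Z}$. (AP) For every integer $1\le q\le x^d$ and every residue class $u\pmod q$ such that no prime $p>\eta$ satisfies $p^2\mid\gcd(u,q)$, we have $$\sup_{\substack{I\text{ interval}\\ |I|\ge H^{1-\varepsilon}\\ I\subset[-(d+3)Hx^d,(d+3)Hx^d]}}\frac{q}{|I|}\Bigg|\sum_{\substack{n\in I\\ n\equiv u\ (\mathrm{mod}\ q)}}f(n)\Bigg|\ll\theta^{-1}.$$ The function $f$ may depend on $H$, provided that the constants in these hypotheses are uniform in $H$. Then, for any polynomial $g\in\mathbb{Z}[t]$ of degree at most $d$ with coefficients in $[-H,H]$ and $g(0)\ne0$, we have $$\sum_{|a|,|b|\le H}\Bigg|\sum_{1\le n\le x}f\big(an+bn^2+g(n)\big)\Bigg|^2\ll\theta^{-1}H^2x^2.$$ The implied constant may depend on $d$, $\varepsilon$, and the implied constants in (B) and (AP).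
   Context: Here $|I|$ is the length of the interval $I\subset\mathbb{R}$, the variables $a,b,n$ run over integers, and in sums over $n\in I$ the variable $n$ is an integer. *)

theory Defs
  imports
    "HOL-Analysis.Analysis"
    "HOL-Computational_Algebra.Computational_Algebra"
    "HOL-Number_Theory.Cong"
begin

definition x_param :: "nat \<Rightarrow> real \<Rightarrow> real" where
  "x_param d H = H powr (1 / (4 * real d))"

definition eta_param :: "nat \<Rightarrow> real \<Rightarrow> real" where
  "eta_param d H = ln (x_param d H) / ln (ln (x_param d H))"

definition theta_param :: "nat \<Rightarrow> real \<Rightarrow> real" where
  "theta_param d H = ln (ln (x_param d H)) / ln (ln (ln (x_param d H)))"

definition condition_B :: "real \<Rightarrow> (int \<Rightarrow> complex) \<Rightarrow> bool" where
  "condition_B C f \<longleftrightarrow> (\<forall>n. norm (f n) \<le> C)"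

text \<open>Intervals of any kind (open, closed, half-open). Membership forces \<open>I\<close> to be bounded, and,
  for \<open>H > 0\<close>, of positive length.\<close>

definition AP_intervals :: "nat \<Rightarrow> real \<Rightarrow> real \<Rightarrow> real set set" where
  "AP_intervals d \<epsilon> H =
     {I. is_interval I \<and> measure lborel I \<ge> H powr (1 - \<epsilon>) \<and>
         I \<subseteq> {- (real d + 3) * H * x_param d H ^ d .. (real d + 3) * H * x_param d H ^ d}}"

text \<open>The supremum is taken in the extended reals, so that bounding it includes the claim
  that it is finite. The condition on \<open>u\<close> depends only on the class of \<open>u\<close> modulo \<open>q\<close>.\<close>

definition condition_AP :: "nat \<Rightarrow> real \<Rightarrow> real \<Rightarrow> real \<Rightarrow> (int \<Rightarrow> complex) \<Rightarrow> bool" where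
  "condition_AP d \<epsilon> C H f \<longleftrightarrow>
     (\<forall>(q::nat) (u::int).
        1 \<le> q \<longrightarrow> real q \<le> x_param d H ^ d \<longrightarrow>
        \<not> (\<exists>p::nat. prime p \<and> real p > eta_param d H \<and> (int p)\<^sup>2 dvd gcd u (int q)) \<longrightarrow>
        (SUP I\<in>AP_intervals d \<epsilon> H.
           ereal (real q / measure lborel I *
             norm (\<Sum>n | real_of_int n \<in> I \<and> [n = u] (mod int q). f n)))
        \<le> ereal (C * inverse (theta_param d H)))"

end

theory Submission
  imports Defs "HOL-Real_Asymp.Real_Asymp"
begin

text \<open>Expand the square and exchange summation: the left-hand side becomes a sum over pairs
  \<open>(m, n)\<close> of correlations of \<open>f(am + bm\<^sup>2 + g(m))\<close> and \<open>f(an + bn\<^sup>2 + g(n))\<close> over \<open>a, b\<close>. By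
  symmetry let \<open>m < n\<close>. On each line \<open>a + bm = k\<close> the first factor is constant, while the argument
  of the second runs through a segment of a residue class modulo \<open>q = n(n - m)\<close>, so
  condition (AP) saves a factor \<open>\<theta>\<close> unless \<open>p\<^sup>2\<close> divides \<open>q\<close> for some prime \<open>p > \<eta>\<close>. Then \<open>p\<^sup>2\<close>
  divides \<open>n\<close> or \<open>n - m\<close>, or \<open>p\<close> divides both \<open>m\<close> and \<open>n\<close>; this happens for \<open>O(x\<^sup>2/p\<^sup>2)\<close> pairs,
  hence for \<open>O(x\<^sup>2/\<eta>)\<close> pairs in total, and \<open>\<theta> \<le> \<eta>\<close>.\<close>

section \<open>Counting pairs whose modulus is divisible by the square of a large prime\<close>

lemma card_multiples_le:
  fixes m N :: int
  assumes "m > 0" "N \<ge> 0"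
  shows "real (card {n \<in> {1..N}. m dvd n}) \<le> real_of_int N / real_of_int m"
proof -
  have "{n \<in> {1..N}. m dvd n} \<subseteq> (\<lambda>j. m * j) ` {1..N div m}"
  proof
    fix n assume "n \<in> {n \<in> {1..N}. m dvd n}"
    then obtain j where j: "n = m * j" and n: "1 \<le> n" "n \<le> N" by auto
    from n(1) j assms have "j > 0" by (smt (verit) mult_nonneg_nonpos)
    moreover have "j \<le> N div m"
      using n(2) j assms by (metis nonzero_mult_div_cancel_left zdiv_mono1 less_irrefl)
    ultimately show "n \<in> (\<lambda>j. m * j) ` {1..N div m}" using j by auto
  qed
  then have "card {n \<in> {1..N}. m dvd n} \<le> card {1..N div m}"
    by (meson card_image_le card_mono finite_atLeastAtMost_int finite_imageI le_trans)
  moreover have "real (card {1..N div m}) = real_of_int (N div m)"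
    using assms by (simp add: pos_imp_zdiv_nonneg_iff)
  ultimately have "real (card {n \<in> {1..N}. m dvd n}) \<le> real_of_int (N div m)"
    by (metis of_nat_le_iff)
  also have "\<dots> \<le> real_of_int N / real_of_int m"
    by (simp add: real_of_int_div4)
  finally show ?thesis .
qed

text \<open>If \<open>p\<close> misses one factor, it is coprime to it, so the whole square falls on
  the other factor.\<close>

lemma prime_square_dvd_mult_cases:
  fixes a b :: int
  assumes "prime p" "p\<^sup>2 dvd a * b"
  shows "p\<^sup>2 dvd a \<or> p\<^sup>2 dvd b \<or> p dvd a \<and> p dvd b"
proof (cases "p dvd a")
  case True
  show ?thesis
  proof (cases "p dvd b")
    case False
    then have "coprime (p\<^sup>2) b" using assms(1) by (simp add: prime_imp_coprime)
    then show ?thesis using assms(2) by (simp add: coprime_dvd_mult_left_iff)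
  qed (use True in auto)
next
  case False
  then have "coprime (p\<^sup>2) a" using assms(1) by (simp add: prime_imp_coprime)
  then show ?thesis using assms(2) by (simp add: coprime_dvd_mult_right_iff)
qed

text \<open>Each of the three cases for \<open>n\<close> and \<open>n - m\<close> contributes at
  most \<open>N\<^sup>2 / p\<^sup>2\<close>, whence the constant 3. Counting multiples from 1 leaves
  no rounding term, so the bound stays summable over all large \<open>p\<close>.\<close>

lemma card_pairs_prime_square_dvd:
  fixes p N :: int
  assumes p: "prime p" and N: "N \<ge> 0"
  shows "real (card {(m, n). 1 \<le> m \<and> m < n \<and> n \<le> N \<and> p\<^sup>2 dvd n * (n - m)})
    \<le> 3 * (real_of_int N)\<^sup>2 / (real_of_int p)\<^sup>2"
proof -
  have p0: "p > 0" using p prime_gt_0_int by blast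
  define M where "M k = {n \<in> {1..N}. k dvd n}" for k
  let ?X = "{(m, n). 1 \<le> m \<and> m < n \<and> n \<le> N \<and> p\<^sup>2 dvd n - m}"
  have fin: "finite (M k)" for k
    by (rule finite_subset[of _ "{1..N}"]) (auto simp: M_def)
  have M: "real (card (M (p\<^sup>2))) \<le> real_of_int N / (real_of_int p)\<^sup>2"
    "real (card (M p)) \<le> real_of_int N / real_of_int p"
    using card_multiples_le[of "p\<^sup>2" N] card_multiples_le[of p N] p0 N by (simp_all add: M_def)
  have Xfin: "finite ?X"
    by (rule finite_subset[of _ "{1..N} \<times> {1..N}"]) auto
  \<comment> \<open>Passing from \<open>(m, n)\<close> to \<open>(m, n - m)\<close> is injective and
    turns the condition on the difference into a count of multiples.\<close>
  have "card ?X \<le> card ({1..N} \<times> M (p\<^sup>2))"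
  proof (rule card_inj_on_le)
    show "inj_on (\<lambda>(m, n). (m, n - m)) ?X" by (auto simp: inj_on_def)
    show "(\<lambda>(m, n). (m, n - m)) ` ?X \<subseteq> {1..N} \<times> M (p\<^sup>2)" by (auto simp: M_def)
  qed (simp add: fin)
  then have X: "card ?X \<le> card {1..N} * card (M (p\<^sup>2))" by (simp add: card_cartesian_product)
  have "{(m, n). 1 \<le> m \<and> m < n \<and> n \<le> N \<and> p\<^sup>2 dvd n * (n - m)}
      \<subseteq> ({1..N} \<times> M (p\<^sup>2)) \<union> ?X \<union> (M p \<times> M p)"
  proof (rule subsetI, unfold mem_Collect_eq, elim case_prodE conjE)
    fix z :: "int \<times> int" and m n :: int
    assume z: "z = (m, n)" and h: "1 \<le> m" "m < n" "n \<le> N" "p\<^sup>2 dvd n * (n - m)"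
    have "p dvd m" if "p dvd n" "p dvd n - m" using dvd_diff[OF that] by simp
    then have "p\<^sup>2 dvd n \<or> p\<^sup>2 dvd n - m \<or> p dvd n \<and> p dvd m"
      using prime_square_dvd_mult_cases[OF p h(4)] by blast
    then show "z \<in> ({1..N} \<times> M (p\<^sup>2)) \<union> ?X \<union> (M p \<times> M p)"
      using h z by (auto simp: M_def)
  qed
  then have "card {(m, n). 1 \<le> m \<and> m < n \<and> n \<le> N \<and> p\<^sup>2 dvd n * (n - m)}
      \<le> card (({1..N} \<times> M (p\<^sup>2)) \<union> ?X \<union> (M p \<times> M p))"
    by (intro card_mono) (auto simp: fin Xfin)
  also have "\<dots> \<le> card ({1..N} \<times> M (p\<^sup>2)) + card ?X + card (M p \<times> M p)"
    by (meson add_le_mono card_Un_le le_refl le_trans)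
  also have "\<dots> \<le> 2 * (card {1..N} * card (M (p\<^sup>2))) + card (M p) * card (M p)"
    using X by (simp add: card_cartesian_product)
  finally have "real (card {(m, n). 1 \<le> m \<and> m < n \<and> n \<le> N \<and> p\<^sup>2 dvd n * (n - m)})
      \<le> real (2 * (card {1..N} * card (M (p\<^sup>2))) + card (M p) * card (M p))"
    by (rule of_nat_mono)
  also have "\<dots> = 2 * (real_of_int N * real (card (M (p\<^sup>2)))) + real (card (M p)) * real (card (M p))"
    using N by simp
  also have "\<dots> \<le> 2 * (real_of_int N * (real_of_int N / (real_of_int p)\<^sup>2))
      + (real_of_int N / real_of_int p) * (real_of_int N / real_of_int p)"
    using M N p0 by (intro add_mono mult_left_mono mult_mono) auto
  also have "\<dots> = 3 * (real_of_int N)\<^sup>2 / (real_of_int p)\<^sup>2"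
    by (simp add: power2_eq_square)
  finally show ?thesis .
qed

text \<open>Comparison with the telescoping series of
  \<open>1 / (k * (k + 1)) = 1 / k - 1 / (k + 1)\<close>.\<close>

lemma sum_inverse_squares_tail:
  fixes E M :: nat
  assumes "1 \<le> E" "E \<le> M"
  shows "(\<Sum>m\<in>{E<..M}. 1 / (real m)\<^sup>2) \<le> 1 / real E - 1 / real M"
  using assms(2)
proof (induction M rule: dec_induct)
  case (step k)
  have "{E<..Suc k} = insert (Suc k) {E<..k}" using step by auto
  moreover have "1 / (real (Suc k))\<^sup>2 \<le> 1 / (real k * real (Suc k))"
    unfolding power2_eq_square using step assms(1)
    by (intro divide_left_mono mult_right_mono mult_pos_pos) auto
  moreover have "1 / (real k * real (Suc k)) = 1 / real k - 1 / real (Suc k)"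
    using step assms(1) by (simp add: field_simps)
  ultimately show ?case using step.IH by simp
qed simp

text \<open>Union bound over the primes above \<eta>; only primes up to \<open>N\<close> can occur,
  so the union is finite. The constant is 3 per prime times the factor 2 lost in replacing \<eta> by
  its floor.\<close>

lemma card_pairs_large_prime_square_dvd:
  fixes N :: int and \<eta> :: real
  assumes N: "N \<ge> 0" and \<eta>: "\<eta> \<ge> 1"
  shows "real (card {(m, n). 1 \<le> m \<and> m < n \<and> n \<le> N \<and>
      (\<exists>p::nat. prime p \<and> real p > \<eta> \<and> (int p)\<^sup>2 dvd n * (n - m))})
    \<le> 6 * (real_of_int N)\<^sup>2 / \<eta>"
proof -
  define E where "E = nat \<lfloor>\<eta>\<rfloor>"
  have E: "1 \<le> E" "\<eta> < real E + 1" unfolding E_def using \<eta> by linarith+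
  define X where "X p = {(m, n). 1 \<le> m \<and> m < n \<and> n \<le> N \<and> (int p)\<^sup>2 dvd n * (n - m)}" for p
  \<comment> \<open>The maximum with \<open>E\<close> secures the hypothesis
    \<open>E \<le> M\<close> of \<open>sum_inverse_squares_tail\<close> even when \<open>N\<close>
    is small.\<close>
  define P where "P = {p. prime p \<and> p \<in> {E<..max E (nat N)}}"
  have finX: "finite (X p)" for p
    by (rule finite_subset[of _ "{1..N} \<times> {1..N}"]) (auto simp: X_def)
  have finP: "finite P" unfolding P_def by simp
  have sub: "{(m, n). 1 \<le> m \<and> m < n \<and> n \<le> N \<and>
      (\<exists>p::nat. prime p \<and> real p > \<eta> \<and> (int p)\<^sup>2 dvd n * (n - m))} \<subseteq> (\<Union>p\<in>P. X p)"
  proof clarify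
    fix m n :: int and p :: nat
    assume mn: "1 \<le> m" "m < n" "n \<le> N" and p: "prime p" "real p > \<eta>" "(int p)\<^sup>2 dvd n * (n - m)"
    have "p > E" using p(2) \<eta> unfolding E_def by linarith
    have "(int p)\<^sup>2 \<le> n * (n - m)" using p(3) mn by (intro zdvd_imp_le) auto
    also have "\<dots> \<le> N * N" using mn by (intro mult_mono) auto
    finally have "(int p)\<^sup>2 \<le> N\<^sup>2" by (simp add: power2_eq_square)
    then have "int p \<le> N" using N by (rule power2_le_imp_le)
    then have "p \<in> P" using p \<open>p > E\<close> by (auto simp: P_def)
    then show "(m, n) \<in> (\<Union>p\<in>P. X p)" using mn p by (auto simp: X_def)
  qed
  have "real (card {(m, n). 1 \<le> m \<and> m < n \<and> n \<le> N \<and>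
      (\<exists>p::nat. prime p \<and> real p > \<eta> \<and> (int p)\<^sup>2 dvd n * (n - m))}) \<le> real (card (\<Union>p\<in>P. X p))"
    using sub finP finX by (intro of_nat_mono card_mono) auto
  also have "\<dots> \<le> (\<Sum>p\<in>P. real (card (X p)))"
    using card_UN_le[OF finP, of X] by (metis of_nat_mono of_nat_sum)
  also have "\<dots> \<le> (\<Sum>p\<in>P. 3 * (real_of_int N)\<^sup>2 * (1 / (real p)\<^sup>2))"
  proof (rule sum_mono)
    fix p assume "p \<in> P"
    then have "prime (int p)" by (simp add: P_def)
    from card_pairs_prime_square_dvd[OF this N]
    show "real (card (X p)) \<le> 3 * (real_of_int N)\<^sup>2 * (1 / (real p)\<^sup>2)"
      by (simp add: X_def)
  qed
  \<comment> \<open>Primality is dropped: the sum over all integers beyond \<open>E\<close> is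
    already small enough.\<close>
  also have "\<dots> \<le> (\<Sum>p\<in>{E<..max E (nat N)}. 3 * (real_of_int N)\<^sup>2 * (1 / (real p)\<^sup>2))"
    by (rule sum_mono2) (auto simp: P_def)
  also have "\<dots> = 3 * (real_of_int N)\<^sup>2 * (\<Sum>p\<in>{E<..max E (nat N)}. 1 / (real p)\<^sup>2)"
    by (simp add: sum_distrib_left)
  also have "\<dots> \<le> 3 * (real_of_int N)\<^sup>2 * (1 / real E - 1 / real (max E (nat N)))"
    using E by (intro mult_left_mono sum_inverse_squares_tail) auto
  also have "\<dots> \<le> 3 * (real_of_int N)\<^sup>2 * (2 / \<eta>)"
  proof (rule mult_left_mono)
    have "\<eta> \<le> 2 * real E" using E by linarith
    then have "2 / (2 * real E) \<le> 2 / \<eta>" using \<eta> by (intro divide_left_mono) auto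
    then have "1 / real E \<le> 2 / \<eta>" by simp
    then show "1 / real E - 1 / real (max E (nat N)) \<le> 2 / \<eta>"
      by (smt (verit) of_nat_0_le_iff zero_le_divide_1_iff)
  qed simp
  finally show ?thesis by simp
qed

section \<open>Cancellation along progressions and the correlation of one pair\<close>

text \<open>If the points \<open>c + q * b\<close> span length at least
  \<open>H powr (1 - \<epsilon>)\<close>, condition (AP) applies; otherwise there are at most
  \<open>H powr (1 - \<epsilon>) / q + 1\<close> of them and (B) suffices. The bound adds both
  cases, so that its users need not distinguish them.\<close>

lemma progression_sum_le:
  fixes f :: "int \<Rightarrow> complex" and q l r c :: int
  assumes AP: "condition_AP d \<epsilon> D H f" and B: "condition_B C f"
    and q: "1 \<le> q" "real_of_int q \<le> x_param d H ^ d"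
    and nop: "\<not> (\<exists>p::nat. prime p \<and> real p > eta_param d H \<and> (int p)\<^sup>2 dvd q)"
    and lr: "l \<le> r"
    and lrange: "\<bar>real_of_int (c + q * l)\<bar> \<le> (real d + 3) * H * x_param d H ^ d"
    and rrange: "\<bar>real_of_int (c + q * r)\<bar> \<le> (real d + 3) * H * x_param d H ^ d"
    and pos: "H > 0" "0 \<le> D * inverse (theta_param d H)" "C \<ge> 0"
  shows "norm (\<Sum>b\<in>{l..r}. f (c + q * b))
    \<le> D * inverse (theta_param d H) * real (card {l..r}) + C * (H powr (1 - \<epsilon>) / real_of_int q + 1)"
proof -
  \<comment> \<open>Both endpoints are terms of the progression, so the normalisation
    \<open>q / measure lborel I\<close> is exactly \<open>1 / (r - l)\<close>.\<close>
  define I where "I = {real_of_int (c + q * l) .. real_of_int (c + q * r)}"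
  have le: "c + q * l \<le> c + q * r" using lr q by (simp add: mult_left_mono)
  have meas: "measure lborel I = real_of_int q * real_of_int (r - l)"
    unfolding I_def using le by (simp add: algebra_simps flip: of_int_mult of_int_add)
  show ?thesis
  proof (cases "measure lborel I \<ge> H powr (1 - \<epsilon>)")
    case True
    have set_eq: "{n. real_of_int n \<in> I \<and> [n = c] (mod int (nat q))} = (\<lambda>b. c + q * b) ` {l..r}"
    proof (intro equalityI subsetI)
      fix n assume "n \<in> {n. real_of_int n \<in> I \<and> [n = c] (mod int (nat q))}"
      then have n: "c + q * l \<le> n" "n \<le> c + q * r" "[n = c] (mod q)"
        using q unfolding I_def by (auto simp flip: of_int_mult of_int_add)
      from n(3) obtain b where "n = c + q * b" by (metis cong_iff_lin cong_sym)
      then show "n \<in> (\<lambda>b. c + q * b) ` {l..r}" using n q by auto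
    next
      fix n assume "n \<in> (\<lambda>b. c + q * b) ` {l..r}"
      then obtain b where b: "n = c + q * b" "l \<le> b" "b \<le> r" by (meson atLeastAtMost_iff imageE)
      then have "c + q * l \<le> n" "n \<le> c + q * r" using q by auto
      then have "real_of_int n \<in> I" unfolding I_def by (simp flip: of_int_mult of_int_add)
      then show "n \<in> {n. real_of_int n \<in> I \<and> [n = c] (mod int (nat q))}"
        using b q by (simp add: cong_def)
    qed
    have sum_eq: "(\<Sum>n | real_of_int n \<in> I \<and> [n = c] (mod int (nat q)). f n)
        = (\<Sum>b\<in>{l..r}. f (c + q * b))"
      unfolding set_eq using q by (subst sum.reindex) (auto simp: inj_on_def)
    have neg: "- (real d + 3) * H * x_param d H ^ d = - ((real d + 3) * H * x_param d H ^ d)"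
      by (simp only: mult_minus_left)
    have "I \<in> AP_intervals d \<epsilon> H"
      unfolding AP_intervals_def neg mem_Collect_eq using True lrange rrange
      unfolding I_def abs_le_iff by (auto simp only: is_interval_cc atLeastatMost_subset_iff)
    then have "ereal (real (nat q) / measure lborel I *
           norm (\<Sum>n | real_of_int n \<in> I \<and> [n = c] (mod int (nat q)). f n))
        \<le> (SUP I\<in>AP_intervals d \<epsilon> H. ereal (real (nat q) / measure lborel I *
           norm (\<Sum>n | real_of_int n \<in> I \<and> [n = c] (mod int (nat q)). f n)))"
      by (rule SUP_upper)
    also have "\<dots> \<le> ereal (D * inverse (theta_param d H))"
    proof -
      \<comment> \<open>The gcd divides \<open>q\<close>, so a modulus free of large prime squares
        makes every residue class \<open>c\<close> admissible.\<close>
      have "1 \<le> nat q" "real (nat q) \<le> x_param d H ^ d"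
        "\<not> (\<exists>p::nat. prime p \<and> real p > eta_param d H \<and> (int p)\<^sup>2 dvd gcd c (int (nat q)))"
        using q nop by auto
      then show ?thesis using AP unfolding condition_AP_def by blast
    qed
    finally have "real_of_int q / measure lborel I * norm (\<Sum>b\<in>{l..r}. f (c + q * b))
        \<le> D * inverse (theta_param d H)"
      using q sum_eq by simp
    moreover have "measure lborel I > 0" using True pos(1) by (smt (verit) powr_gt_zero)
    then have w: "real_of_int (r - l) > 0" using meas q by (simp add: zero_less_mult_iff)
    moreover have "real_of_int q / measure lborel I = 1 / real_of_int (r - l)"
      using meas q by simp
    ultimately have "norm (\<Sum>b\<in>{l..r}. f (c + q * b)) / real_of_int (r - l)
        \<le> D * inverse (theta_param d H)" by simp
    then have "norm (\<Sum>b\<in>{l..r}. f (c + q * b))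
        \<le> D * inverse (theta_param d H) * real_of_int (r - l)"
      using w by (simp only: pos_divide_le_eq)
    also have "\<dots> \<le> D * inverse (theta_param d H) * real (card {l..r})"
      using pos(2) lr by (intro mult_left_mono) auto
    also have "\<dots> \<le> \<dots> + C * (H powr (1 - \<epsilon>) / real_of_int q + 1)"
      using pos q by simp
    finally show ?thesis .
  next
    case False
    then have "real_of_int (r - l) \<le> H powr (1 - \<epsilon>) / real_of_int q"
      using meas q by (simp add: field_simps)
    then have card: "real (card {l..r}) \<le> H powr (1 - \<epsilon>) / real_of_int q + 1" using lr by simp
    have "norm (\<Sum>b\<in>{l..r}. f (c + q * b)) \<le> (\<Sum>b\<in>{l..r}. C)"
      using B unfolding condition_B_def by (intro sum_norm_le) auto
    also have "\<dots> = C * real (card {l..r})" by simp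
    also have "\<dots> \<le> C * (H powr (1 - \<epsilon>) / real_of_int q + 1)"
      using card pos by (intro mult_left_mono) auto
    finally show ?thesis using pos
      by (smt (verit) mult_nonneg_nonneg of_nat_0_le_iff)
  qed
qed

text \<open>This keeps all arguments of \<open>f\<close> inside the window of (AP). At most
  \<open>d + 1\<close> monomials come from \<open>g\<close> and two more from \<open>a\<close> and
  \<open>b\<close>, each at most \<open>H * x ^ d\<close>; the quadratic one needs
  \<open>d \<ge> 2\<close>.\<close>

lemma perturbed_poly_bound:
  fixes g :: "int poly" and a b n :: int and H x :: real
  assumes "d \<ge> 2" "degree g \<le> d" "\<And>i. \<bar>real_of_int (coeff g i)\<bar> \<le> H"
    and "\<bar>real_of_int a\<bar> \<le> H" "\<bar>real_of_int b\<bar> \<le> H" "1 \<le> n" "real_of_int n \<le> x"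
  shows "\<bar>real_of_int (a * n + b * n\<^sup>2 + poly g n)\<bar> \<le> (real d + 3) * H * x ^ d"
proof -
  have H: "H \<ge> 0" using assms(4) by linarith
  have n1: "1 \<le> real_of_int n" using assms(6) by simp
  have x1: "1 \<le> x" using assms(6,7) by linarith
  have pw: "real_of_int n ^ i \<le> x ^ d" if "i \<le> d" for i
  proof -
    have "real_of_int n ^ i \<le> x ^ i" using assms(7) n1 by (intro power_mono) auto
    also have "\<dots> \<le> x ^ d" using that x1 by (intro power_increasing) auto
    finally show ?thesis .
  qed
  have monomial: "\<bar>y * real_of_int n ^ i\<bar> \<le> H * x ^ d" if "i \<le> d" "\<bar>y\<bar> \<le> H" for y i
    using that pw[OF that(1)] n1 H by (simp add: abs_mult mult_mono)
  have "\<bar>real_of_int (poly g n)\<bar> = \<bar>\<Sum>i\<le>degree g. real_of_int (coeff g i) * real_of_int n ^ i\<bar>"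
    by (simp add: poly_altdef)
  also have "\<dots> \<le> (\<Sum>i\<le>degree g. \<bar>real_of_int (coeff g i) * real_of_int n ^ i\<bar>)"
    by (rule sum_abs)
  also have "\<dots> \<le> (\<Sum>i\<le>degree g. H * x ^ d)"
    using assms(2,3) by (intro sum_mono monomial) auto
  also have "\<dots> = (real (degree g) + 1) * (H * x ^ d)" by simp
  also have "\<dots> \<le> (real d + 1) * (H * x ^ d)"
    using assms(2) H x1 by (intro mult_right_mono) auto
  finally have g: "\<bar>real_of_int (poly g n)\<bar> \<le> (real d + 1) * (H * x ^ d)" .
  have "\<bar>real_of_int a * real_of_int n ^ 1\<bar> \<le> H * x ^ d"
    "\<bar>real_of_int b * real_of_int n ^ 2\<bar> \<le> H * x ^ d"
    using assms by (intro monomial; simp)+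
  with g show ?thesis by (simp add: algebra_simps)
qed

lemma int_set_eq_atLeastAtMost:
  fixes B :: "int set"
  assumes "finite B" "B \<noteq> {}" "\<And>l b r. l \<in> B \<Longrightarrow> r \<in> B \<Longrightarrow> l \<le> b \<Longrightarrow> b \<le> r \<Longrightarrow> b \<in> B"
  shows "B = {Min B..Max B}"
  using assms by (meson Max_in Max_ge Min_in Min_le atLeastAtMost_iff subsetI subset_antisym)

text \<open>Segments shorter than \<open>H powr (1 - \<epsilon>)\<close> are bounded trivially. Taking \<open>m < n\<close> makes the
  modulus \<open>n (n - m)\<close> at least \<open>m\<close>, which compensates for the \<open>O(H m)\<close> values of \<open>a + b m\<close>.\<close>

lemma correlation_le:
  fixes f :: "int \<Rightarrow> complex" and g :: "int poly" and m n :: int and H :: real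
  defines "A \<equiv> {a::int. \<bar>real_of_int a\<bar> \<le> H}"
  assumes d: "d \<ge> 2" and AP: "condition_AP d \<epsilon> D H f" and B: "condition_B C f"
    and g: "degree g \<le> d" "\<And>i. \<bar>real_of_int (coeff g i)\<bar> \<le> H"
    and mn: "1 \<le> m" "m < n" "real_of_int n \<le> x_param d H"
    and nop: "\<not> (\<exists>p::nat. prime p \<and> real p > eta_param d H \<and> (int p)\<^sup>2 dvd n * (n - m))"
    and H: "H \<ge> 1" and D: "D \<ge> 0" and \<theta>: "theta_param d H > 0" and C: "C \<ge> 0"
  shows "norm (\<Sum>a\<in>A. \<Sum>b\<in>A. f (a * m + b * m\<^sup>2 + poly g m) * cnj (f (a * n + b * n\<^sup>2 + poly g n)))
    \<le> C * (D * inverse (theta_param d H)) * (real (card A))\<^sup>2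
      + 5 * C\<^sup>2 * (H powr (2 - \<epsilon>) + H * x_param d H)"
proof -
  define x where "x = x_param d H"
  define \<theta>' where "\<theta>' = D * inverse (theta_param d H)"
  have \<theta>'0: "\<theta>' \<ge> 0" unfolding \<theta>'_def using D \<theta> by simp
  have finA: "finite A"
    by (rule finite_subset[of _ "{-\<lfloor>H\<rfloor>..\<lfloor>H\<rfloor>}"]) (auto simp: A_def abs_le_iff le_floor_iff, linarith)
  define q where "q = n * (n - m)"
  have q1: "1 \<le> q" and mq: "m \<le> q"
    using mn unfolding q_def by (smt (verit) mult_le_cancel_left1)+
  have x1: "1 \<le> x" using mn unfolding x_def by linarith
  have "real_of_int q \<le> x\<^sup>2"
    unfolding q_def power2_eq_square of_int_mult using mn x1 by (intro mult_mono) (auto simp: x_def)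
  also have "\<dots> \<le> x ^ d" using d x1 by (intro power_increasing) auto
  finally have qx: "real_of_int q \<le> x ^ d" .
  \<comment> \<open>\<open>K\<close> indexes the lines \<open>a + b * m = k\<close>,
    \<open>P k\<close> holds the points of a line, and \<open>Bk k\<close> is its projection to the
    coordinate \<open>b\<close>, which determines \<open>a\<close>.\<close>
  define K where "K = (\<lambda>(a, b). a + b * m) ` (A \<times> A)"
  define P where "P k = {(a, b) \<in> A \<times> A. a + b * m = k}" for k
  define Bk where "Bk k = {b \<in> A. k - b * m \<in> A}" for k
  define F where "F a b j = f (a * j + b * j\<^sup>2 + poly g j)" for a b j
  have finK: "finite K" unfolding K_def using finA by simp
  have finB: "finite (Bk k)" for k unfolding Bk_def using finA by simp
  have bij: "bij_betw (\<lambda>b. (k - b * m, b)) (Bk k) (P k)" for k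
    by (rule bij_betw_byWitness[where f' = snd]) (auto simp: Bk_def P_def)
  \<comment> \<open>Kept general in the summand: it serves both the complex correlation and, with
    the constant 1, the count of pairs.\<close>
  have group: "(\<Sum>k\<in>K. \<Sum>b\<in>Bk k. G (k - b * m) b) = (\<Sum>(a, b)\<in>A \<times> A. G a b)"
    for G :: "int \<Rightarrow> int \<Rightarrow> 'a::comm_monoid_add"
  proof -
    have "(\<Sum>(a, b)\<in>A \<times> A. G a b) = (\<Sum>k\<in>K. \<Sum>ab\<in>P k. case ab of (a, b) \<Rightarrow> G a b)"
      unfolding P_def by (subst sum.group[symmetric, of "A \<times> A" K "\<lambda>(a, b). a + b * m"])
        (auto simp: finA finK K_def case_prod_beta intro!: sum.cong)
    also have "\<dots> = (\<Sum>k\<in>K. \<Sum>b\<in>Bk k. G (k - b * m) b)"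
      by (intro sum.cong refl) (subst sum.reindex_bij_betw[OF bij, symmetric], simp)
    finally show ?thesis by simp
  qed
  have inner: "norm (\<Sum>b\<in>Bk k. F (k - b * m) b m * cnj (F (k - b * m) b n))
      \<le> C * (\<theta>' * real (card (Bk k)) + C * (H powr (1 - \<epsilon>) / real_of_int q + 1))" if "k \<in> K" for k
  proof -
    define c where "c = n * k + poly g n"
    \<comment> \<open>Substituting \<open>a = k - b * m\<close> cancels \<open>b\<close> at
      \<open>m\<close> and leaves the linear term \<open>n * (n - m) * b\<close> at
      \<open>n\<close>.\<close>
    have Fm: "F (k - b * m) b m = f (k * m + poly g m)" for b
      unfolding F_def by (simp add: algebra_simps power2_eq_square)
    have Fn: "F (k - b * m) b n = f (c + q * b)" and argn: "(k - b * m) * n + b * n\<^sup>2 + poly g n = c + q * b" for b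
      unfolding F_def c_def q_def by (simp_all add: algebra_simps power2_eq_square)
    have ne: "Bk k \<noteq> {}" using that unfolding K_def Bk_def by force
    define l r where "l = Min (Bk k)" and "r = Max (Bk k)"
    have lr: "l \<in> Bk k" "r \<in> Bk k" unfolding l_def r_def using ne finB by auto
    \<comment> \<open>Both constraints defining \<open>Bk k\<close> bound a linear function of
      \<open>b\<close>, so the set has no gaps.\<close>
    have Beq: "Bk k = {l..r}"
      unfolding l_def r_def
    proof (rule int_set_eq_atLeastAtMost[OF finB ne])
      fix l b r assume h: "l \<in> Bk k" "r \<in> Bk k" "l \<le> b" "b \<le> r"
      then have le: "l * m \<le> b * m" "b * m \<le> r * m" using mn by auto
      have "\<bar>real_of_int b\<bar> \<le> H" using h unfolding Bk_def A_def by auto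
      moreover have "\<bar>real_of_int (k - b * m)\<bar> \<le> H"
      proof -
        have "real_of_int (k - r * m) \<le> real_of_int (k - b * m)"
          "real_of_int (k - b * m) \<le> real_of_int (k - l * m)"
          using le by (simp_all only: of_int_le_iff)
        moreover have "\<bar>real_of_int (k - l * m)\<bar> \<le> H" "\<bar>real_of_int (k - r * m)\<bar> \<le> H"
          using h unfolding Bk_def A_def by auto
        ultimately show ?thesis by linarith
      qed
      ultimately show "b \<in> Bk k" unfolding Bk_def A_def by simp
    qed
    have range: "\<bar>real_of_int (c + q * b)\<bar> \<le> (real d + 3) * H * x ^ d" if "b \<in> Bk k" for b
      using perturbed_poly_bound[OF d g, of "k - b * m" b n x] that mn
      unfolding argn by (auto simp: Bk_def A_def x_def)
    have "norm (\<Sum>b\<in>Bk k. F (k - b * m) b m * cnj (F (k - b * m) b n))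
        = norm (f (k * m + poly g m)) * norm (\<Sum>b\<in>{l..r}. f (c + q * b))"
      unfolding Fm Fn Beq by (simp add: sum_distrib_left[symmetric] norm_mult flip: cnj_sum)
    also have "\<dots> \<le> C * (\<theta>' * real (card {l..r}) + C * (H powr (1 - \<epsilon>) / real_of_int q + 1))"
    proof (intro mult_mono)
      show "norm (f (k * m + poly g m)) \<le> C" using B unfolding condition_B_def by simp
      show "norm (\<Sum>b\<in>{l..r}. f (c + q * b))
          \<le> \<theta>' * real (card {l..r}) + C * (H powr (1 - \<epsilon>) / real_of_int q + 1)"
        unfolding \<theta>'_def
      proof (rule progression_sum_le[OF AP B q1])
        show "l \<le> r" using lr Beq by auto
      qed (use qx nop range lr H C \<theta>'0 in \<open>auto simp: x_def q_def \<theta>'_def\<close>)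
    qed (use C in auto)
    finally show ?thesis by (simp add: Beq)
  qed
  \<comment> \<open>Here \<open>\<bar>k\<bar> \<le> H + H * m \<le> 2 * H * m\<close>, giving at
    most \<open>4 * H * m + 1\<close> values; the 1 is absorbed by \<open>H * m\<close>.\<close>
  have cardK: "real (card K) \<le> 5 * H * real_of_int m"
  proof -
    have hm: "H \<le> H * real_of_int m" "0 \<le> H * real_of_int m" using mn H by auto
    define w where "w = \<lfloor>2 * H * real_of_int m\<rfloor>"
    have w: "w \<ge> 0" unfolding w_def using hm by simp
    have "K \<subseteq> {-w..w}"
    proof
      fix k assume "k \<in> K"
      then obtain a b where ab: "k = a + b * m" "\<bar>real_of_int a\<bar> \<le> H" "\<bar>real_of_int b\<bar> \<le> H"
        by (auto simp: K_def A_def)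
      have "\<bar>real_of_int b * real_of_int m\<bar> \<le> H * real_of_int m"
        using ab mn by (simp add: abs_mult)
      then have "\<bar>real_of_int k\<bar> \<le> 2 * H * real_of_int m" using ab hm by simp
      then have "\<bar>k\<bar> \<le> w" unfolding w_def by (simp add: le_floor_iff)
      then show "k \<in> {-w..w}" by auto
    qed
    then have "card K \<le> card {-w..w}" by (intro card_mono) auto
    then have "real (card K) \<le> 2 * real_of_int w + 1" using w by simp
    also have "\<dots> \<le> 2 * (2 * H * real_of_int m) + H * real_of_int m"
      using hm H of_int_floor_le[of "2 * H * real_of_int m"] unfolding w_def by linarith
    finally show ?thesis by simp
  qed
  \<comment> \<open>The fibres partition \<open>A \<times> A\<close>, so the main terms add up
    without loss.\<close>
  have cards: "(\<Sum>k\<in>K. real (card (Bk k))) = (real (card A))\<^sup>2"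
    using group[of "\<lambda>_ _. 1 :: real"] by (simp add: card_cartesian_product power2_eq_square case_prod_beta)
  have "(\<Sum>a\<in>A. \<Sum>b\<in>A. f (a * m + b * m\<^sup>2 + poly g m) * cnj (f (a * n + b * n\<^sup>2 + poly g n)))
      = (\<Sum>k\<in>K. \<Sum>b\<in>Bk k. F (k - b * m) b m * cnj (F (k - b * m) b n))"
    unfolding group[of "\<lambda>a b. F a b m * cnj (F a b n)"] unfolding F_def by (simp add: sum.cartesian_product)
  then have "norm (\<Sum>a\<in>A. \<Sum>b\<in>A. f (a * m + b * m\<^sup>2 + poly g m) * cnj (f (a * n + b * n\<^sup>2 + poly g n)))
      \<le> (\<Sum>k\<in>K. C * (\<theta>' * real (card (Bk k)) + C * (H powr (1 - \<epsilon>) / real_of_int q + 1)))"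
    using inner by (simp add: sum_norm_le)
  also have "\<dots> = C * \<theta>' * (\<Sum>k\<in>K. real (card (Bk k)))
      + C\<^sup>2 * (real (card K) * (H powr (1 - \<epsilon>) / real_of_int q + 1))"
    by (simp add: sum.distrib sum_distrib_left algebra_simps power2_eq_square)
  also have "\<dots> \<le> C * \<theta>' * (real (card A))\<^sup>2 + C\<^sup>2 * (5 * (H powr (2 - \<epsilon>) + H * x))"
  proof (intro add_mono mult_left_mono)
    have Hp: "H * H powr (1 - \<epsilon>) = H powr (2 - \<epsilon>)"
      using powr_add[of H 1 "1 - \<epsilon>"] H by simp
    have "real (card K) * (H powr (1 - \<epsilon>) / real_of_int q + 1)
        \<le> 5 * H * real_of_int m * (H powr (1 - \<epsilon>) / real_of_int q + 1)"
      using cardK q1 by (intro mult_right_mono) auto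
    also have "\<dots> = 5 * ((H * H powr (1 - \<epsilon>)) * (real_of_int m / real_of_int q) + H * real_of_int m)"
      by (simp add: algebra_simps)
    also have "\<dots> \<le> 5 * ((H * H powr (1 - \<epsilon>)) * 1 + H * x)"
      using mq q1 mn H by (intro mult_left_mono add_mono) (auto simp: x_def)
    finally show "real (card K) * (H powr (1 - \<epsilon>) / real_of_int q + 1)
        \<le> 5 * (H powr (2 - \<epsilon>) + H * x)" by (simp add: Hp)
  qed (use cards C \<theta>'0 in auto)
  finally show ?thesis by (simp add: x_def \<theta>'_def algebra_simps)
qed

section \<open>Expansion of the square and size of the parameters\<close>

lemma sum_norm_square_eq_correlations:
  fixes F :: "'a \<Rightarrow> 'b \<Rightarrow> complex"
  shows "of_real (\<Sum>i\<in>I. (norm (\<Sum>n\<in>S. F i n))\<^sup>2) = (\<Sum>m\<in>S. \<Sum>n\<in>S. \<Sum>i\<in>I. F i m * cnj (F i n))"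
proof -
  have "of_real (\<Sum>i\<in>I. (norm (\<Sum>n\<in>S. F i n))\<^sup>2) = (\<Sum>i\<in>I. \<Sum>m\<in>S. \<Sum>n\<in>S. F i m * cnj (F i n))"
    by (simp only: of_real_sum complex_norm_square cnj_sum sum_product)
  also have "\<dots> = (\<Sum>m\<in>S. \<Sum>i\<in>I. \<Sum>n\<in>S. F i m * cnj (F i n))" by (rule sum.swap)
  also have "\<dots> = (\<Sum>m\<in>S. \<Sum>n\<in>S. \<Sum>i\<in>I. F i m * cnj (F i n))"
    by (intro sum.cong refl sum.swap)
  finally show ?thesis .
qed

text \<open>Each comparison with \<theta> absorbs one error: with \<open>x\<close> the diagonal,
  with \<eta> the pairs excluded from (AP), with \<open>H powr \<epsilon>\<close> the short
  segments, and \<open>\<theta> * x \<le> H\<close> the extra 1 per line.\<close>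

lemma eventually_parameters:
  assumes "d \<ge> 2" "\<epsilon> > 0"
  shows "\<forall>\<^sub>F H in at_top. H \<ge> 1 \<and> x_param d H \<ge> 1 \<and> eta_param d H \<ge> 1 \<and> theta_param d H > 0 \<and>
    theta_param d H \<le> x_param d H \<and> theta_param d H \<le> eta_param d H \<and>
    theta_param d H \<le> H powr \<epsilon> \<and> theta_param d H * x_param d H \<le> H"
proof -
  have lim: "filterlim (x_param d) at_top at_top"
    unfolding x_param_def using assms by real_asymp
  \<comment> \<open>With this exponent \<open>x powr c = H powr \<epsilon>\<close>, so all
    asymptotics can be stated in \<open>x\<close> alone.\<close>
  define c where "c = 4 * real d * \<epsilon>"
  have c: "c > 0" using assms by (simp add: c_def)
  have "\<forall>\<^sub>F y::real in at_top. y \<ge> 1 \<and> ln y / ln (ln y) \<ge> 1 \<and> ln (ln y) / ln (ln (ln y)) > 0 \<and>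
      ln (ln y) / ln (ln (ln y)) \<le> y \<and> ln (ln y) / ln (ln (ln y)) \<le> ln y / ln (ln y) \<and>
      ln (ln y) / ln (ln (ln y)) \<le> y powr c"
    using c by (intro eventually_conj; real_asymp)
  from eventually_compose_filterlim[OF this lim]
  show ?thesis using eventually_ge_at_top[of 1]
  proof eventually_elim
    case (elim H)
    define x where "x = x_param d H"
    have x4: "x powr (4 * real d) = H" using elim assms unfolding x_def x_param_def by (simp add: powr_powr)
    then have "x powr c = H powr \<epsilon>" unfolding c_def by (metis powr_powr)
    moreover have "x * x \<le> H"
    proof -
      have "x * x = x powr 2" using elim by (simp add: x_def powr_numeral power2_eq_square)
      also have "\<dots> \<le> x powr (4 * real d)" using elim assms by (intro powr_mono) (auto simp: x_def)
      finally show ?thesis using x4 by simp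
    qed
    moreover have "theta_param d H * x \<le> x * x"
      using elim by (intro mult_right_mono) (auto simp: x_def theta_param_def)
    ultimately show ?case using elim
      by (auto simp: x_def eta_param_def theta_param_def)
  qed
qed

section \<open>Summation over all pairs\<close>

theorem theorem5p1:
  fixes d :: nat and \<epsilon> :: real
  assumes "d \<ge> 2" and "\<epsilon> > 0"
  shows "\<exists>H\<^sub>0::real. \<forall>C\<^sub>B>0. \<forall>C\<^sub>A\<^sub>P>0. \<exists>C>0. \<forall>H\<ge>H\<^sub>0. \<forall>f :: int \<Rightarrow> complex.
    condition_B C\<^sub>B f \<longrightarrow> condition_AP d \<epsilon> C\<^sub>A\<^sub>P H f \<longrightarrow>
    (\<forall>g :: int poly.
       degree g \<le> d \<longrightarrow> (\<forall>i. \<bar>real_of_int (coeff g i)\<bar> \<le> H) \<longrightarrow> poly g 0 \<noteq> 0 \<longrightarrow>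
       (\<Sum>a | \<bar>real_of_int a\<bar> \<le> H. \<Sum>b | \<bar>real_of_int b\<bar> \<le> H.
          (norm (\<Sum>n | 1 \<le> n \<and> real_of_int n \<le> x_param d H. f (a * n + b * n\<^sup>2 + poly g n)))\<^sup>2)
       \<le> C * inverse (theta_param d H) * H\<^sup>2 * (x_param d H)\<^sup>2)"
proof -
  \<comment> \<open>The threshold is fixed before the constants of (B) and (AP), so it depends on
    \<open>d\<close> and \<epsilon> only.\<close>
  obtain H\<^sub>0 where H\<^sub>0: "\<And>H. H \<ge> H\<^sub>0 \<Longrightarrow> H \<ge> 1 \<and> x_param d H \<ge> 1 \<and> eta_param d H \<ge> 1 \<and> theta_param d H > 0 \<and>
    theta_param d H \<le> x_param d H \<and> theta_param d H \<le> eta_param d H \<and>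
    theta_param d H \<le> H powr \<epsilon> \<and> theta_param d H * x_param d H \<le> H"
    using eventually_parameters[OF assms] unfolding eventually_at_top_linorder by blast
  show ?thesis
  proof (rule exI[of _ H\<^sub>0], intro allI impI)
    fix C D :: real assume C: "C > 0" and D: "D > 0"
    \<comment> \<open>Twice the coefficient of \<open>Lo_sum\<close> plus that of
      \<open>diag\<close>: \<open>137 = 2 * (54 + 10) + 9\<close> and
      \<open>18 = 2 * 9\<close>.\<close>
    define C' where "C' = 137 * C\<^sup>2 + 18 * (C * D)"
    have "C' > 0" using C D unfolding C'_def by (intro add_pos_pos) auto
    moreover have "(\<Sum>a | \<bar>real_of_int a\<bar> \<le> H. \<Sum>b | \<bar>real_of_int b\<bar> \<le> H.
          (norm (\<Sum>n | 1 \<le> n \<and> real_of_int n \<le> x_param d H. f (a * n + b * n\<^sup>2 + poly g n)))\<^sup>2)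
       \<le> C' * inverse (theta_param d H) * H\<^sup>2 * (x_param d H)\<^sup>2"
      if HH: "H \<ge> H\<^sub>0" and B: "condition_B C f" and AP: "condition_AP d \<epsilon> D H f"
        and g: "degree g \<le> d" "\<forall>i. \<bar>real_of_int (coeff g i)\<bar> \<le> H"
      for H :: real and f :: "int \<Rightarrow> complex" and g :: "int poly"
    proof -
      define x \<eta> \<theta> where "x = x_param d H" and "\<eta> = eta_param d H" and "\<theta> = theta_param d H"
      have par: "H \<ge> 1" "x \<ge> 1" "\<eta> \<ge> 1" "\<theta> > 0" "\<theta> \<le> x" "\<theta> \<le> \<eta>" "\<theta> \<le> H powr \<epsilon>" "\<theta> * x \<le> H"
        using H\<^sub>0[OF HH] by (auto simp: x_def \<eta>_def \<theta>_def)
      define A where "A = {a::int. \<bar>real_of_int a\<bar> \<le> H}"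
      define N where "N = \<lfloor>x\<rfloor>"
      have N: "1 \<le> N" "real_of_int N \<le> x" unfolding N_def using par by simp_all
      have S: "{n. 1 \<le> n \<and> real_of_int n \<le> x_param d H} = {1..N}"
        unfolding N_def x_def by (auto simp: le_floor_iff)
      have A_eq: "A = {-\<lfloor>H\<rfloor>..\<lfloor>H\<rfloor>}"
        unfolding A_def by (auto simp: abs_le_iff le_floor_iff) linarith+
      have cardA: "real (card A) \<le> 3 * H"
        unfolding A_eq using par by simp linarith
      then have cardA2: "(real (card A))\<^sup>2 \<le> 9 * H\<^sup>2"
        using power_mono[OF cardA, of 2] by (simp add: power_mult_distrib)
      define F where "F = (\<lambda>(a, b) n. f (a * n + b * n\<^sup>2 + poly g n))"
      define T where "T m n = (\<Sum>ab\<in>A \<times> A. F ab m * cnj (F ab n))" for m n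
      define bad where "bad = {(m, n). 1 \<le> m \<and> m < n \<and> n \<le> N \<and>
        (\<exists>p::nat. prime p \<and> real p > \<eta> \<and> (int p)\<^sup>2 dvd n * (n - m))}"
      \<comment> \<open>The target size of one correlation; summed over the
        \<open>O(x\<^sup>2)\<close> pairs it gives the claimed bound.\<close>
      define R where "R = H\<^sup>2 / \<theta>"
      have triv: "norm (T m n) \<le> 9 * C\<^sup>2 * H\<^sup>2" for m n
      proof -
        have "norm (F ab m * cnj (F ab n)) \<le> C * C" for ab
          using B C unfolding condition_B_def F_def norm_mult
          by (intro mult_mono) (auto simp: case_prod_beta)
        then have "norm (T m n) \<le> (\<Sum>ab\<in>A \<times> A. C * C)" unfolding T_def by (intro sum_norm_le) auto
        also have "\<dots> = C\<^sup>2 * (real (card A))\<^sup>2" by (simp add: card_cartesian_product power2_eq_square)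
        also have "\<dots> \<le> C\<^sup>2 * (9 * H\<^sup>2)" using cardA2 by (intro mult_left_mono) auto
        finally show ?thesis by simp
      qed
      have good: "norm (T m n) \<le> (9 * (C * D) + 10 * C\<^sup>2) * R"
        if "1 \<le> m" "m < n" "n \<le> N" "(m, n) \<notin> bad" for m n
      proof -
        have "T m n = (\<Sum>a\<in>A. \<Sum>b\<in>A. f (a * m + b * m\<^sup>2 + poly g m) * cnj (f (a * n + b * n\<^sup>2 + poly g n)))"
          unfolding T_def F_def by (simp add: sum.cartesian_product case_prod_beta)
        also have "norm \<dots> \<le> C * (D * inverse \<theta>) * (real (card A))\<^sup>2
            + 5 * C\<^sup>2 * (H powr (2 - \<epsilon>) + H * x)"
          unfolding A_def \<theta>_def x_def
        proof (rule correlation_le[OF assms(1) AP B])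
          show "real_of_int n \<le> x_param d H" using that N unfolding x_def by linarith
          show "\<not> (\<exists>p::nat. prime p \<and> real p > eta_param d H \<and> (int p)\<^sup>2 dvd n * (n - m))"
            using that unfolding bad_def \<eta>_def by auto
        qed (use that g par C D in \<open>auto simp: \<theta>_def\<close>)
        also have "\<dots> \<le> C * (D * inverse \<theta>) * (9 * H\<^sup>2) + 5 * C\<^sup>2 * (R + R)"
        proof (intro add_mono mult_left_mono cardA2)
          have "H powr (2 - \<epsilon>) = H\<^sup>2 / H powr \<epsilon>"
            using par by (simp add: powr_diff powr_numeral)
          also have "\<dots> \<le> R" unfolding R_def using par by (intro divide_left_mono) auto
          finally show "H powr (2 - \<epsilon>) \<le> R" .
          have "H * (\<theta> * x) \<le> H * H" using par by (intro mult_left_mono) auto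
          then show "H * x \<le> R" unfolding R_def using par
            by (simp add: field_simps power2_eq_square)
        qed (use C D par in auto)
        finally show ?thesis by (simp add: R_def divide_inverse algebra_simps)
      qed
      define Lo where "Lo = {(m, n). 1 \<le> m \<and> m < n \<and> n \<le> N}"
      have Lo_sub: "Lo \<subseteq> {1..N} \<times> {1..N}" unfolding Lo_def by auto
      have finLo: "finite Lo" using Lo_sub finite_subset by blast
      have "bad \<subseteq> Lo" unfolding bad_def Lo_def by auto
      have cardLo: "real (card Lo) \<le> x\<^sup>2"
      proof -
        have "card Lo \<le> card ({1..N} \<times> {1..N})" using Lo_sub by (intro card_mono) auto
        then have "real (card Lo) \<le> real (card ({1..N} \<times> {1..N}))" by (rule of_nat_mono)
        also have "\<dots> = (real_of_int N)\<^sup>2"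
          using N by (simp add: card_cartesian_product power2_eq_square)
        also have "\<dots> \<le> x\<^sup>2" using N by (intro power_mono) auto
        finally show ?thesis .
      qed
      \<comment> \<open>The scarcity of bad pairs supplies the saving of \<theta> that the trivial
        bound \<open>triv\<close> lacks.\<close>
      have cardbad: "real (card bad) \<le> 6 * x\<^sup>2 / \<theta>"
      proof -
        have "real (card bad) \<le> 6 * (real_of_int N)\<^sup>2 / \<eta>"
          unfolding bad_def using N par by (intro card_pairs_large_prime_square_dvd) auto
        also have "\<dots> \<le> 6 * x\<^sup>2 / \<theta>"
          using N par by (intro frac_le mult_left_mono power_mono) auto
        finally show ?thesis .
      qed
      \<comment> \<open>\<open>T\<close> is Hermitian, so the pairs with \<open>m > n\<close> reduce
        to those in \<open>Lo\<close>.\<close>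
      have sym: "norm (T m n) = norm (T n m)" for m n
      proof -
        have "T m n = cnj (T n m)" unfolding T_def by (simp add: mult.commute)
        then show ?thesis by simp
      qed
      have Lo_sum: "(\<Sum>(m, n)\<in>Lo. norm (T m n)) \<le> (54 * C\<^sup>2 + (9 * (C * D) + 10 * C\<^sup>2)) * (R * x\<^sup>2)"
      proof -
        have "(\<Sum>(m, n)\<in>Lo. norm (T m n))
            \<le> (\<Sum>mn\<in>Lo. (if mn \<in> bad then 9 * C\<^sup>2 * H\<^sup>2 else 0) + (9 * (C * D) + 10 * C\<^sup>2) * R)"
        proof (rule sum_mono, clarify)
          fix m n assume "(m, n) \<in> Lo"
          moreover have "0 \<le> (9 * (C * D) + 10 * C\<^sup>2) * R" using C D par by (simp add: R_def)
          ultimately show "norm (T m n)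
              \<le> (if (m, n) \<in> bad then 9 * C\<^sup>2 * H\<^sup>2 else 0) + (9 * (C * D) + 10 * C\<^sup>2) * R"
            using triv[of m n] good[of m n] by (auto simp: Lo_def)
        qed
        also have "\<dots> = real (card bad) * (9 * C\<^sup>2 * H\<^sup>2) + real (card Lo) * ((9 * (C * D) + 10 * C\<^sup>2) * R)"
          using finLo \<open>bad \<subseteq> Lo\<close>
          by (simp add: sum.distrib Int_absorb1 flip: sum.inter_restrict)
        also have "\<dots> \<le> (6 * x\<^sup>2 / \<theta>) * (9 * C\<^sup>2 * H\<^sup>2) + x\<^sup>2 * ((9 * (C * D) + 10 * C\<^sup>2) * R)"
          using cardbad cardLo C D par by (intro add_mono mult_right_mono) (auto simp: R_def)
        also have "\<dots> = (54 * C\<^sup>2 + (9 * (C * D) + 10 * C\<^sup>2)) * (R * x\<^sup>2)"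
          by (simp add: R_def algebra_simps)
        finally show ?thesis .
      qed
      have diag: "(\<Sum>n\<in>{1..N}. norm (T n n)) \<le> 9 * C\<^sup>2 * (R * x\<^sup>2)"
      proof -
        have "(\<Sum>n\<in>{1..N}. norm (T n n)) \<le> (\<Sum>n\<in>{1..N}. 9 * C\<^sup>2 * H\<^sup>2)" by (intro sum_mono triv)
        also have "\<dots> = real_of_int N * (9 * C\<^sup>2 * H\<^sup>2)" using N by simp
        \<comment> \<open>The diagonal has only \<open>O(x)\<close> terms, and
          \<open>\<theta> \<le> x\<close> makes this \<open>O(x\<^sup>2 / \<theta>)\<close>.\<close>
        also have "\<dots> \<le> (x\<^sup>2 / \<theta>) * (9 * C\<^sup>2 * H\<^sup>2)"
        proof (rule mult_right_mono)
          have "x * \<theta> \<le> x * x" using par by (intro mult_left_mono) auto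
          then have "x \<le> x\<^sup>2 / \<theta>" using par by (simp add: field_simps power2_eq_square)
          then show "real_of_int N \<le> x\<^sup>2 / \<theta>" using N by linarith
        qed simp
        finally show ?thesis by (simp add: R_def algebra_simps)
      qed
      have "(\<Sum>a\<in>A. \<Sum>b\<in>A. (norm (\<Sum>n\<in>{1..N}. f (a * n + b * n\<^sup>2 + poly g n)))\<^sup>2)
          = (\<Sum>ab\<in>A \<times> A. (norm (\<Sum>n\<in>{1..N}. F ab n))\<^sup>2)"
        unfolding F_def by (simp add: sum.cartesian_product case_prod_beta)
      \<comment> \<open>The nonnegative real sum is read as a complex norm, so that the correlation
        identity and the triangle inequality apply.\<close>
      also have "\<dots> = norm (of_real (\<Sum>ab\<in>A \<times> A. (norm (\<Sum>n\<in>{1..N}. F ab n))\<^sup>2) :: complex)"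
        unfolding norm_of_real by (simp add: sum_nonneg)
      also have "\<dots> = norm (\<Sum>m\<in>{1..N}. \<Sum>n\<in>{1..N}. T m n)"
        unfolding sum_norm_square_eq_correlations T_def ..
      also have "\<dots> \<le> (\<Sum>mn\<in>{1..N} \<times> {1..N}. norm (case mn of (m, n) \<Rightarrow> T m n))"
        unfolding sum.cartesian_product by (rule norm_sum)
      also have "{1..N} \<times> {1..N} = (Lo \<union> prod.swap ` Lo) \<union> (\<lambda>n. (n, n)) ` {1..N}"
        unfolding Lo_def by (auto simp: image_iff)
      also have "(\<Sum>mn\<in>(Lo \<union> prod.swap ` Lo) \<union> (\<lambda>n. (n, n)) ` {1..N}. norm (case mn of (m, n) \<Rightarrow> T m n))
          = (\<Sum>mn\<in>Lo. norm (case mn of (m, n) \<Rightarrow> T m n))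
            + (\<Sum>mn\<in>prod.swap ` Lo. norm (case mn of (m, n) \<Rightarrow> T m n))
            + (\<Sum>mn\<in>(\<lambda>n. (n, n)) ` {1..N}. norm (case mn of (m, n) \<Rightarrow> T m n))"
        using finLo by (subst sum.union_disjoint; (subst sum.union_disjoint)?) (auto simp: Lo_def)
      also have "(\<Sum>mn\<in>prod.swap ` Lo. norm (case mn of (m, n) \<Rightarrow> T m n)) = (\<Sum>(m, n)\<in>Lo. norm (T m n))"
        by (subst sum.reindex) (auto simp: case_prod_beta sym intro!: sum.cong)
      also have "(\<Sum>mn\<in>(\<lambda>n. (n, n)) ` {1..N}. norm (case mn of (m, n) \<Rightarrow> T m n)) = (\<Sum>n\<in>{1..N}. norm (T n n))"
        by (subst sum.reindex) (auto simp: inj_on_def)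
      also have "(\<Sum>mn\<in>Lo. norm (case mn of (m, n) \<Rightarrow> T m n)) = (\<Sum>(m, n)\<in>Lo. norm (T m n))"
        by (simp add: case_prod_beta)
      also have "(\<Sum>(m, n)\<in>Lo. norm (T m n)) + (\<Sum>(m, n)\<in>Lo. norm (T m n)) + (\<Sum>n\<in>{1..N}. norm (T n n))
          \<le> C' * (R * x\<^sup>2)"
        using Lo_sum diag unfolding C'_def by (simp add: algebra_simps)
      finally show ?thesis
        unfolding S A_def[symmetric] by (simp add: R_def x_def \<theta>_def divide_inverse mult_ac)
    qed
    ultimately show "\<exists>C'>0. \<forall>H\<ge>H\<^sub>0. \<forall>f :: int \<Rightarrow> complex.
      condition_B C f \<longrightarrow> condition_AP d \<epsilon> D H f \<longrightarrow>
      (\<forall>g :: int poly.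
         degree g \<le> d \<longrightarrow> (\<forall>i. \<bar>real_of_int (coeff g i)\<bar> \<le> H) \<longrightarrow> poly g 0 \<noteq> 0 \<longrightarrow>
         (\<Sum>a | \<bar>real_of_int a\<bar> \<le> H. \<Sum>b | \<bar>real_of_int b\<bar> \<le> H.
            (norm (\<Sum>n | 1 \<le> n \<and> real_of_int n \<le> x_param d H. f (a * n + b * n\<^sup>2 + poly g n)))\<^sup>2)
         \<le> C' * inverse (theta_param d H) * H\<^sup>2 * (x_param d H)\<^sup>2)"
      by blast
  qed
qed

end
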